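(* Let $n\ge 24$. For each integer $a$ with $3\le a\le \lfloor (n-15)/3\rfloor$ and $n-a\equiv 1\pmod 2$, every integer in the interval $\left[\binom{a-1}{2}+1,\ \binom{a}{2}\right]$ is an eigenvalue of $\mathrm{Cay}(S_n,T_n)$.
   Context: $S_n$ is the symmetric group on $\{1,\dots,n\}$ and $T_n\subseteq S_n$ is the set of all transpositions. The transposition graph $\mathrm{Cay}(S_n,T_n)$ is the Cayley graph with vertex set $S_n$ in which $f,g\in S_n$ are adjacent iff $fg^{-1}\in T_n$. Its eigenvalues are the eigenvalues of its adjacency matrix. *)

theory Defs
  imports
    "HOL-Algebra.Sym_Groups"
    "HOL-Number_Theory.Cong"
    "Graph_Theory.Pair_Digraph"
    "Jordan_Normal_Form.Char_Poly"
begin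

definition transpositions :: "nat \<Rightarrow> (nat \<Rightarrow> nat) set" where
  "transpositions n = {transpose i j | i j. i \<in> {1..n} \<and> j \<in> {1..n} \<and> i \<noteq> j}"

text \<open>An undirected graph is represented by its symmetric set of arcs; the arc set below is
  symmetric as soon as \<^term>\<open>T\<close> is closed under inverses, as the transpositions are.\<close>

definition cayley_graph :: "('a, 'b) monoid_scheme \<Rightarrow> 'a set \<Rightarrow> 'a pair_pre_digraph" where
  "cayley_graph G T =
     \<lparr> pverts = carrier G,
       parcs = {(f, g). f \<in> carrier G \<and> g \<in> carrier G \<and> f \<otimes>\<^bsub>G\<^esub> inv\<^bsub>G\<^esub> g \<in> T} \<rparr>"

definition transposition_graph :: "nat \<Rightarrow> (nat \<Rightarrow> nat) pair_pre_digraph" where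
  "transposition_graph n = cayley_graph (sym_group n) (transpositions n)"

text \<open>Matrices are indexed by natural numbers, so the adjacency matrix depends on an enumeration
  \<^term>\<open>vs\<close> of the vertices.\<close>

definition adjacency_mat :: "'v pair_pre_digraph \<Rightarrow> 'v list \<Rightarrow> real mat" where
  "adjacency_mat G vs =
     mat (length vs) (length vs) (\<lambda>(i, j). if (vs ! i, vs ! j) \<in> parcs G then 1 else 0)"

definition graph_eigenvalue :: "'v pair_pre_digraph \<Rightarrow> real \<Rightarrow> bool" where
  "graph_eigenvalue G x \<longleftrightarrow>
     (\<exists>vs. distinct vs \<and> set vs = pverts G \<and> eigenvalue (adjacency_mat G vs) x)"

text \<open>The right-hand side does not mention \<^term>\<open>vs\<close>, so the choice of the enumeration in
  \<^const>\<open>graph_eigenvalue\<close> is immaterial.\<close>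

lemma eigenvalue_adjacency_mat_iff:
  assumes d: "distinct vs" and s: "set vs = V"
  shows "eigenvalue (adjacency_mat G vs) x \<longleftrightarrow>
    (\<exists>f. (\<exists>v\<in>V. f v \<noteq> 0) \<and>
         (\<forall>u\<in>V. (\<Sum>v\<in>V. if (u, v) \<in> parcs G then f v else 0) = x * f u))"
proof -
  let ?n = "length vs"
  have reidx: "(\<Sum>v\<in>V. h v) = (\<Sum>j<?n. h (vs ! j))" for h :: "'a \<Rightarrow> real"
    using sum.reindex_bij_betw[OF bij_betw_nth[OF d refl s[symmetric]], of h] by simp
  have row: "(adjacency_mat G vs *\<^sub>v w) $ i
      = (\<Sum>j<?n. if (vs ! i, vs ! j) \<in> parcs G then w $ j else 0)"
    if "i < ?n" "dim_vec w = ?n" for i w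
    using that unfolding adjacency_mat_def
    by (auto simp: scalar_prod_def lessThan_atLeast0 intro!: sum.cong)
  have ev: "eigenvalue (adjacency_mat G vs) x \<longleftrightarrow>
    (\<exists>w. dim_vec w = ?n \<and> (\<exists>i<?n. w $ i \<noteq> 0) \<and>
      (\<forall>i<?n. (\<Sum>j<?n. if (vs ! i, vs ! j) \<in> parcs G then w $ j else 0) = x * w $ i))"
  proof -
    have dim: "dim_row (adjacency_mat G vs) = ?n" by (simp add: adjacency_mat_def)
    have "eigenvector (adjacency_mat G vs) w x \<longleftrightarrow>
      dim_vec w = ?n \<and> (\<exists>i<?n. w $ i \<noteq> 0) \<and>
      (\<forall>i<?n. (\<Sum>j<?n. if (vs ! i, vs ! j) \<in> parcs G then w $ j else 0) = x * w $ i)" for w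
    proof (cases "dim_vec w = ?n")
      case True
      have "w \<noteq> 0\<^sub>v ?n \<longleftrightarrow> (\<exists>i<?n. w $ i \<noteq> 0)"
        using True by (auto simp: vec_eq_iff)
      moreover have "adjacency_mat G vs *\<^sub>v w = x \<cdot>\<^sub>v w \<longleftrightarrow>
        (\<forall>i<?n. (adjacency_mat G vs *\<^sub>v w) $ i = x * w $ i)"
        using True dim by (simp add: vec_eq_iff del: index_mult_mat_vec)
      moreover have "w \<in> carrier_vec ?n" using True by (rule carrier_vecI)
      ultimately have "eigenvector (adjacency_mat G vs) w x \<longleftrightarrow> (\<exists>i<?n. w $ i \<noteq> 0) \<and>
        (\<forall>i<?n. (adjacency_mat G vs *\<^sub>v w) $ i = x * w $ i)"
        unfolding eigenvector_def dim by blast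
      also have "(\<forall>i<?n. (adjacency_mat G vs *\<^sub>v w) $ i = x * w $ i) \<longleftrightarrow>
        (\<forall>i<?n. (\<Sum>j<?n. if (vs ! i, vs ! j) \<in> parcs G then w $ j else 0) = x * w $ i)"
        by (intro all_cong) (simp only: row[OF _ True])
      finally show ?thesis using True by blast
    next
      case False
      then show ?thesis unfolding eigenvector_def dim by (blast dest: carrier_vecD)
    qed
    then show ?thesis unfolding eigenvalue_def by simp
  qed
  show ?thesis
  proof
    assume "eigenvalue (adjacency_mat G vs) x"
    then obtain w where w: "\<exists>i<?n. w $ i \<noteq> 0"
      "\<forall>i<?n. (\<Sum>j<?n. if (vs ! i, vs ! j) \<in> parcs G then w $ j else 0) = x * w $ i"
      unfolding ev by blast
    define f where "f v = w $ (THE i. i < ?n \<and> vs ! i = v)" for v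
    have f: "f (vs ! i) = w $ i" if "i < ?n" for i
      unfolding f_def using that d
      by (intro arg_cong[where f = "vec_index w"] the_equality) (auto simp: nth_eq_iff_index_eq)
    have "\<exists>v\<in>V. f v \<noteq> 0"
    proof -
      obtain i where i: "i < ?n" "w $ i \<noteq> 0" using w(1) by blast
      have "vs ! i \<in> V" using i(1) s by auto
      then show ?thesis using f[OF i(1)] i(2) by (intro bexI[of _ "vs ! i"]) simp_all
    qed
    moreover have "\<forall>u\<in>V. (\<Sum>v\<in>V. if (u, v) \<in> parcs G then f v else 0) = x * f u"
    proof
      fix u assume "u \<in> V"
      then obtain i where i: "i < ?n" "u = vs ! i" using s by (metis in_set_conv_nth)
      have "(\<Sum>v\<in>V. if (u, v) \<in> parcs G then f v else 0)
          = (\<Sum>j<?n. if (vs ! i, vs ! j) \<in> parcs G then w $ j else 0)"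
        unfolding reidx i(2) by (intro sum.cong) (auto simp: f)
      then show "(\<Sum>v\<in>V. if (u, v) \<in> parcs G then f v else 0) = x * f u"
        using w(2) i f by simp
    qed
    ultimately show "\<exists>f. (\<exists>v\<in>V. f v \<noteq> 0) \<and>
         (\<forall>u\<in>V. (\<Sum>v\<in>V. if (u, v) \<in> parcs G then f v else 0) = x * f u)" by blast
  next
    assume "\<exists>f. (\<exists>v\<in>V. f v \<noteq> 0) \<and>
         (\<forall>u\<in>V. (\<Sum>v\<in>V. if (u, v) \<in> parcs G then f v else 0) = x * f u)"
    then obtain f where f: "\<exists>v\<in>V. f v \<noteq> 0"
      "\<forall>u\<in>V. (\<Sum>v\<in>V. if (u, v) \<in> parcs G then f v else 0) = x * f u" by blast
    let ?w = "vec ?n (\<lambda>i. f (vs ! i))"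
    have "\<exists>i<?n. ?w $ i \<noteq> 0"
    proof -
      obtain v where v: "v \<in> V" "f v \<noteq> 0" using f(1) by blast
      then obtain i where "i < ?n" "v = vs ! i" using s by (metis in_set_conv_nth)
      then show ?thesis using v(2) by (intro exI[of _ i]) simp
    qed
    moreover have "(\<Sum>j<?n. if (vs ! i, vs ! j) \<in> parcs G then ?w $ j else 0) = x * ?w $ i"
      if i: "i < ?n" for i
    proof -
      have "(\<Sum>j<?n. if (vs ! i, vs ! j) \<in> parcs G then ?w $ j else 0)
          = (\<Sum>v\<in>V. if (vs ! i, v) \<in> parcs G then f v else 0)"
        unfolding reidx by (intro sum.cong) auto
      then show ?thesis using f(2) i s by auto
    qed
    ultimately show "eigenvalue (adjacency_mat G vs) x"
      unfolding ev by (intro exI[of _ ?w]) auto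
  qed
qed

end

theory Submission
  imports Defs
begin

text \<open>Let \<open>D\<close> be a Young diagram with \<open>n\<close> cells, labelled by \<open>1, \<dots>, n\<close>. The Specht polynomial of \<open>D\<close>
  (the product over the columns of the Vandermonde products of the variables in the column), evaluated
  at the values of a permutation, is a nowhere vanishing function on the symmetric group. Exchanging
  two cells of one column changes its sign; exchanging a fixed cell with all the cells of a column
  further left, and summing, reproduces it, by Lagrange interpolation. It is therefore an eigenvector
  of the transposition graph, whose eigenvalue is the sum of the contents \<open>j - i\<close> of the cells
  \<open>(i, j)\<close> of \<open>D\<close>.

  In Frobenius coordinates, a set of arms \<open>A\<close> and a set of legs \<open>B\<close> of the same size give a diagram
  with \<open>\<Sum>A + \<Sum>B + |A|\<close> cells and content sum \<open>\<Sum>\<^sub>A \<alpha>(\<alpha>+1)/2 - \<Sum>\<^sub>B \<beta>(\<beta>+1)/2\<close>. For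
  \<open>n = 2m + 1 + a\<close>, the arms \<open>m - r, a - 1, r - 1\<close> and the legs \<open>m - r, r, 0\<close> give the content sum
  \<open>a(a-1)/2 - r\<close>, and there are substitutes for the few \<open>r\<close> where two of these numbers coincide.\<close>

section \<open>Vandermonde products and Lagrange interpolation\<close>

definition vandermonde :: "'i::linorder set \<Rightarrow> ('i \<Rightarrow> 'a::comm_ring_1) \<Rightarrow> 'a" where
  "vandermonde I z = (\<Prod>(i, k)\<in>{(i, k). i \<in> I \<and> k \<in> I \<and> i < k}. z i - z k)"

text \<open>The factors containing \<open>z p\<close> are split off; those whose other index is
  smaller than \<open>p\<close> have \<open>z p\<close> in second place, and turning each of them
  round costs one sign. This isolates the dependence on a single variable.\<close>

lemma vandermonde_remove:
  fixes I :: "'i::linorder set"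
  assumes I: "finite I" and p: "p \<in> I"
  shows "vandermonde I z = (- 1) ^ card {k \<in> I. k < p} * (\<Prod>k\<in>I - {p}. z p - z k)
    * vandermonde (I - {p}) (z :: 'i \<Rightarrow> 'a::comm_ring_1)"
proof -
  let ?P = "\<lambda>I. {(i, k). i \<in> I \<and> k \<in> I \<and> i < k}"
  let ?L = "{k \<in> I. k < p}" and ?R = "{k \<in> I. p < k}"
  have fin: "finite (?P (I - {p}))"
    by (rule finite_subset[of _ "I \<times> I"]) (use I in auto)
  have "?P I = ?P (I - {p}) \<union> ((\<lambda>k. (k, p)) ` ?L \<union> (\<lambda>k. (p, k)) ` ?R)"
    using p by auto
  then have "vandermonde I z = vandermonde (I - {p}) z *
      (\<Prod>(i, k)\<in>(\<lambda>k. (k, p)) ` ?L \<union> (\<lambda>k. (p, k)) ` ?R. z i - z k)"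
    unfolding vandermonde_def using fin I by (simp only:) (subst prod.union_disjoint; auto)
  also have "(\<Prod>(i, k)\<in>(\<lambda>k. (k, p)) ` ?L \<union> (\<lambda>k. (p, k)) ` ?R. z i - z k)
      = (\<Prod>k\<in>?L. z k - z p) * (\<Prod>k\<in>?R. z p - z k)"
    using I by (subst prod.union_disjoint) (auto simp: prod.reindex inj_on_def)
  also have "(\<Prod>k\<in>?L. z k - z p) = (\<Prod>k\<in>?L. - 1 * (z p - z k))"
    by simp
  also have "\<dots> = (- 1) ^ card ?L * (\<Prod>k\<in>?L. z p - z k)"
    unfolding prod.distrib by simp
  also have "\<dots> * (\<Prod>k\<in>?R. z p - z k) = (- 1) ^ card ?L * (\<Prod>k\<in>?L \<union> ?R. z p - z k)"
    using I by (subst prod.union_disjoint) (auto simp: mult.assoc)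
  also have "?L \<union> ?R = I - {p}"
    using p by auto
  finally show ?thesis by (simp add: mult_ac)
qed

lemma vandermonde_cong:
  "(\<And>i. i \<in> I \<Longrightarrow> z i = w i) \<Longrightarrow> vandermonde I z = vandermonde I w"
  unfolding vandermonde_def by (rule prod.cong) auto

lemma vandermonde_nonzero:
  fixes z :: "'i::linorder \<Rightarrow> 'a::idom"
  assumes "finite I" "inj_on z I"
  shows "vandermonde I z \<noteq> 0"
proof -
  have "finite {(i, k). i \<in> I \<and> k \<in> I \<and> i < k}"
    by (rule finite_subset[of _ "I \<times> I"]) (use assms in auto)
  then show ?thesis
    unfolding vandermonde_def using assms(2) by (auto simp: inj_on_def)
qed

lemma vandermonde_upd:
  assumes "finite I" "p \<in> I"
  shows "vandermonde I (z(p := t)) = (- 1) ^ card {k \<in> I. k < p} * (\<Prod>k\<in>I - {p}. t - z k)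
    * vandermonde (I - {p}) z"
proof -
  have "vandermonde (I - {p}) (z(p := t)) = vandermonde (I - {p}) z"
    by (rule vandermonde_cong) auto
  moreover have "(\<Prod>k\<in>I - {p}. (z(p := t)) p - (z(p := t)) k) = (\<Prod>k\<in>I - {p}. t - z k)"
    by (rule prod.cong) auto
  ultimately show ?thesis
    by (simp only: vandermonde_remove[OF assms])
qed

text \<open>Splitting off both \<open>p\<close> and \<open>q\<close> leaves a sign \<open>s\<close>
  that depends on the indices alone. The swap interchanges the products of \<open>p\<close> and of
  \<open>q\<close> with the remaining indices, and only the factor \<open>z p - z q\<close> changes
  sign.\<close>

lemma vandermonde_swap:
  assumes I: "finite I" and pq: "p \<in> I" "q \<in> I" "p \<noteq> q"
  shows "vandermonde I (z(p := z q, q := z p)) = - vandermonde I z"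
proof -
  let ?w = "z(p := z q, q := z p)"
  let ?J = "I - {p} - {q}"
  define s where "s = (- 1) ^ card {k \<in> I. k < p} * (- 1 :: 'b) ^ card {k \<in> I - {p}. k < q}"
  have split: "vandermonde I y = s * (y p - y q) * (\<Prod>k\<in>?J. y p - y k) * (\<Prod>k\<in>?J. y q - y k)
      * vandermonde ?J y" for y :: "'a \<Rightarrow> 'b"
  proof -
    have "(\<Prod>k\<in>I - {p}. y p - y k) = (y p - y q) * (\<Prod>k\<in>?J. y p - y k)"
      using I pq by (intro prod.remove) auto
    then show ?thesis
      using vandermonde_remove[OF I pq(1), of y] vandermonde_remove[of "I - {p}" q y] I pq
      by (simp add: s_def mult_ac)
  qed
  have "vandermonde ?J ?w = vandermonde ?J z"
    by (rule vandermonde_cong) auto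
  moreover have "(\<Prod>k\<in>?J. ?w p - ?w k) = (\<Prod>k\<in>?J. z q - z k)"
    by (rule prod.cong) (use pq in auto)
  moreover have "(\<Prod>k\<in>?J. ?w q - ?w k) = (\<Prod>k\<in>?J. z p - z k)"
    by (rule prod.cong) (use pq in auto)
  ultimately have "vandermonde I ?w = s * (z q - z p) * (\<Prod>k\<in>?J. z q - z k)
      * (\<Prod>k\<in>?J. z p - z k) * vandermonde ?J z"
    using pq by (simp only: split[of ?w]) simp
  then show ?thesis
    unfolding split[of z] by (simp add: algebra_simps)
qed

text \<open>The interpolant \<open>Q\<close> and \<open>P\<close> both have degree below
  \<open>card I\<close> and agree at the \<open>card I\<close> distinct nodes, so they are the same
  polynomial.\<close>

lemma lagrange_interpolation:
  fixes z :: "'i \<Rightarrow> 'a::field"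
  assumes I: "finite I" and inj: "inj_on z I" and deg: "degree P < card I"
  shows "(\<Sum>p\<in>I. poly P (z p) * (\<Prod>k\<in>I - {p}. (u - z k) / (z p - z k))) = poly P u"
proof -
  define Q where "Q = (\<Sum>p\<in>I. Polynomial.smult (poly P (z p) / (\<Prod>k\<in>I - {p}. z p - z k))
    (\<Prod>k\<in>I - {p}. [:- z k, 1:]))"
  have Q: "poly Q t = (\<Sum>p\<in>I. poly P (z p) * (\<Prod>k\<in>I - {p}. (t - z k) / (z p - z k)))" for t
    unfolding Q_def by (simp add: poly_sum poly_prod prod_dividef)
  have "degree Q \<le> card I - 1"
    unfolding Q_def
  proof (rule degree_sum_le[OF I])
    fix p assume p: "p \<in> I"
    have "degree (\<Prod>k\<in>I - {p}. [:- z k, 1:]) \<le> sum (degree \<circ> (\<lambda>k. [:- z k, 1:])) (I - {p})"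
      by (rule degree_prod_sum_le) (use I in simp)
    also have "\<dots> = card I - 1"
      using I p by simp
    finally show "degree (Polynomial.smult (poly P (z p) / (\<Prod>k\<in>I - {p}. z p - z k))
        (\<Prod>k\<in>I - {p}. [:- z k, 1:])) \<le> card I - 1"
      using degree_smult_le order_trans by blast
  qed
  then have degQ: "degree Q < card I"
    using deg by simp
  have "poly Q y = poly P y" if y: "y \<in> z ` I" for y
  proof -
    from y obtain q where q: "q \<in> I" "y = z q" by auto
    have "poly Q y = (\<Sum>p\<in>I. if p = q then poly P (z q) else 0)"
      unfolding Q q(2)
    proof (rule sum.cong[OF refl])
      fix p assume p: "p \<in> I"
      show "poly P (z p) * (\<Prod>k\<in>I - {p}. (z q - z k) / (z p - z k))
          = (if p = q then poly P (z q) else 0)"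
      proof (cases "p = q")
        case True
        have "(\<Prod>k\<in>I - {q}. (z q - z k) / (z q - z k)) = 1"
          using inj q(1) by (intro prod.neutral) (auto simp: inj_on_def)
        then show ?thesis using True by simp
      next
        case False
        then have "(\<Prod>k\<in>I - {p}. (z q - z k) / (z p - z k)) = 0"
          using I q(1) by (intro prod_zero) auto
        then show ?thesis using False by simp
      qed
    qed
    then show ?thesis using I q by simp
  qed
  then have "Q = P"
    by (rule poly_eqI_degree) (use degQ deg card_image[OF inj] in auto)
  then show ?thesis
    using Q[of u] by simp
qed

text \<open>As a function of \<open>t\<close>, \<^term>\<open>vandermonde J (w(q := t))\<close> is a polynomial of degree
  \<^term>\<open>card J - 1\<close>; the sum is its Lagrange interpolation at the nodes \<^term>\<open>z ` I\<close>, taken at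
  \<^term>\<open>w q\<close>.\<close>

lemma vandermonde_exchange:
  fixes z :: "'i::linorder \<Rightarrow> 'a::field"
  assumes I: "finite I" and inj: "inj_on z I" and J: "finite J" "q \<in> J" "card J \<le> card I"
  shows "(\<Sum>p\<in>I. vandermonde I (z(p := w q)) * vandermonde J (w(q := z p)))
    = vandermonde I z * vandermonde J w"
proof -
  define P where "P = Polynomial.smult ((- 1) ^ card {k \<in> J. k < q} * vandermonde (J - {q}) w)
    (\<Prod>k\<in>J - {q}. [:- w k, 1:])"
  have P: "poly P t = vandermonde J (w(q := t))" for t
    unfolding P_def vandermonde_upd[OF J(1,2)] by (simp add: poly_prod mult_ac)
  have "degree P \<le> degree (\<Prod>k\<in>J - {q}. [:- w k, 1:])"
    unfolding P_def by (rule degree_smult_le)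
  also have "\<dots> \<le> sum (degree \<circ> (\<lambda>k. [:- w k, 1:])) (J - {q})"
    by (rule degree_prod_sum_le) (use J in simp)
  also have "\<dots> = card J - 1"
    using J by simp
  also have "\<dots> < card I"
    using J card_gt_0_iff[of J] by auto
  finally have deg: "degree P < card I" .
  \<comment> \<open>The sign and the Vandermonde product of \<open>I - {p}\<close> cancel in the
    quotient, which leaves the Lagrange basis polynomial of the node \<open>z p\<close>, evaluated
    at \<open>w q\<close>.\<close>
  have ratio: "vandermonde I (z(p := w q))
      = vandermonde I z * (\<Prod>k\<in>I - {p}. (w q - z k) / (z p - z k))" if p: "p \<in> I" for p
  proof -
    have "(\<Prod>k\<in>I - {p}. z p - z k) \<noteq> 0"
      using I inj p by (auto simp: inj_on_def)
    then show ?thesis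
      unfolding vandermonde_upd[OF I p] vandermonde_remove[OF I p, of z] prod_dividef
      by (simp add: field_simps)
  qed
  have "(\<Sum>p\<in>I. vandermonde I (z(p := w q)) * vandermonde J (w(q := z p)))
      = (\<Sum>p\<in>I. vandermonde I z * (poly P (z p) * (\<Prod>k\<in>I - {p}. (w q - z k) / (z p - z k))))"
    by (rule sum.cong) (simp_all add: ratio P)
  also have "\<dots> = vandermonde I z * poly P (w q)"
    unfolding sum_distrib_left[symmetric] lagrange_interpolation[OF I inj deg] ..
  finally show ?thesis by (simp add: P)
qed

section \<open>Specht polynomials of Young diagrams\<close>

text \<open>Cells are pairs (row, column), both counted from 0, so the corner is
  \<open>(0, 0)\<close>.\<close>

definition young_diagram :: "(nat \<times> nat) set \<Rightarrow> bool" where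
  "young_diagram D \<longleftrightarrow> finite D \<and>
     (\<forall>i j i' j'. (i, j) \<in> D \<longrightarrow> i' \<le> i \<longrightarrow> j' \<le> j \<longrightarrow> (i', j') \<in> D)"

definition column :: "(nat \<times> nat) set \<Rightarrow> nat \<Rightarrow> nat set" where
  "column D j = {i. (i, j) \<in> D}"

text \<open>The variables are indexed by cells rather than by numbers, so a labelling of the cells
  enters only through the choice of \<open>x\<close>.\<close>

definition specht :: "(nat \<times> nat) set \<Rightarrow> (nat \<times> nat \<Rightarrow> 'a::field) \<Rightarrow> 'a" where
  "specht D x = (\<Prod>j\<in>snd ` D. vandermonde (column D j) (\<lambda>i. x (i, j)))"

lemma finite_column: "finite D \<Longrightarrow> finite (column D j)"
  unfolding column_def by (rule finite_subset[of _ "fst ` D"]) force+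

lemma specht_cong:
  assumes "\<And>c. c \<in> D \<Longrightarrow> x c = y c"
  shows "specht D x = specht D y"
  unfolding specht_def using assms by (intro prod.cong vandermonde_cong) (auto simp: column_def)

lemma specht_nonzero:
  assumes "finite D" "inj_on x D"
  shows "specht D x \<noteq> 0"
proof -
  have "inj_on (\<lambda>i. x (i, j)) (column D j)" for j
    using assms(2) by (auto simp: inj_on_def column_def)
  then show ?thesis
    unfolding specht_def using assms(1) by (auto simp: vandermonde_nonzero finite_column)
qed

lemma specht_same_column:
  assumes D: "finite D" and c: "(p, j) \<in> D" "(q, j) \<in> D" "p \<noteq> q"
  shows "specht D (x \<circ> transpose (p, j) (q, j)) = - specht D x"
proof -
  let ?y = "x \<circ> transpose (p, j) (q, j)"
  let ?V = "\<lambda>x j. vandermonde (column D j) (\<lambda>i. x (i, j))"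
  have j: "j \<in> snd ` D" using c by force
  have split: "specht D x = ?V x j * (\<Prod>l\<in>snd ` D - {j}. ?V x l)" for x :: "nat \<times> nat \<Rightarrow> 'a"
    unfolding specht_def using D j by (simp add: prod.remove)
  have "(\<Prod>l\<in>snd ` D - {j}. ?V ?y l) = (\<Prod>l\<in>snd ` D - {j}. ?V x l)"
    by (intro prod.cong vandermonde_cong) (auto simp: transpose_def)
  moreover have "(\<lambda>i. ?y (i, j)) = (\<lambda>i. x (i, j))(p := x (q, j), q := x (p, j))"
    by (auto simp: transpose_def fun_eq_iff)
  then have "?V ?y j = - ?V x j"
    using vandermonde_swap[of "column D j" p q "\<lambda>i. x (i, j)"] c finite_column[OF D]
    by (simp add: column_def)
  ultimately show ?thesis
    unfolding split by simp
qed

text \<open>Exchanging the two values affects only the Vandermonde factors of columns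
  \<open>j\<close> and \<open>l\<close>, and gives exactly the summands of
  \<open>vandermonde_exchange\<close>. Its size condition holds because columns of a diagram do not
  grow to the right.\<close>

lemma specht_other_column:
  fixes x :: "nat \<times> nat \<Rightarrow> 'a::field"
  assumes D: "young_diagram D" and inj: "inj_on x D" and d: "(q, l) \<in> D" and jl: "j < l"
  shows "(\<Sum>p\<in>column D j. specht D (x \<circ> transpose (p, j) (q, l))) = specht D x"
proof -
  let ?V = "\<lambda>x j. vandermonde (column D j) (\<lambda>i. x (i, j))"
  have fin: "finite D" using D by (simp add: young_diagram_def)
  have "(q, j) \<in> D"
    using D d jl unfolding young_diagram_def by (meson less_imp_le order_refl)
  then have jl': "j \<in> snd ` D" "l \<in> snd ` D - {j}"
    using d jl by force+
  define R where "R x = (\<Prod>m\<in>snd ` D - {j} - {l}. ?V x m)" for x :: "nat \<times> nat \<Rightarrow> 'a"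
  have split: "specht D x = ?V x j * ?V x l * R x" for x
    unfolding specht_def R_def using fin jl' by (simp add: prod.remove mult.assoc)
  have swap: "specht D (x \<circ> transpose (p, j) (q, l))
      = vandermonde (column D j) ((\<lambda>i. x (i, j))(p := x (q, l)))
        * vandermonde (column D l) ((\<lambda>i. x (i, l))(q := x (p, j))) * R x" for p
  proof -
    let ?y = "x \<circ> transpose (p, j) (q, l)"
    have "(\<lambda>i. ?y (i, j)) = (\<lambda>i. x (i, j))(p := x (q, l))"
      using jl by (auto simp: transpose_def fun_eq_iff)
    moreover have "(\<lambda>i. ?y (i, l)) = (\<lambda>i. x (i, l))(q := x (p, j))"
      using jl by (auto simp: transpose_def fun_eq_iff)
    moreover have "R ?y = R x"
      unfolding R_def by (intro prod.cong vandermonde_cong) (auto simp: transpose_def)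
    ultimately show ?thesis
      unfolding split by simp
  qed
  have "column D l \<subseteq> column D j"
    using D jl unfolding young_diagram_def column_def by (blast intro: less_imp_le)
  then have "card (column D l) \<le> card (column D j)"
    using finite_column[OF fin] card_mono by blast
  moreover have "inj_on (\<lambda>i. x (i, j)) (column D j)"
    using inj by (auto simp: inj_on_def column_def)
  ultimately have "(\<Sum>p\<in>column D j. vandermonde (column D j) ((\<lambda>i. x (i, j))(p := x (q, l)))
        * vandermonde (column D l) ((\<lambda>i. x (i, l))(q := x (p, j)))) = ?V x j * ?V x l"
    using vandermonde_exchange[of "column D j" "\<lambda>i. x (i, j)" "column D l" q "\<lambda>i. x (i, l)"]
      finite_column[OF fin] d by (simp add: column_def)
  then show ?thesis
    unfolding swap sum_distrib_right[symmetric] by (simp add: split)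
qed

text \<open>A total order that reads the diagram column by column. It selects each unordered pair of
  cells once, and the cells before a given one are all the columns to its left and the cells above
  it.\<close>

definition cell_before :: "nat \<times> nat \<Rightarrow> nat \<times> nat \<Rightarrow> bool" where
  "cell_before c d \<longleftrightarrow> snd c < snd d \<or> snd c = snd d \<and> fst c < fst d"

text \<open>For a fixed cell \<open>(q, l)\<close>, each of the \<open>l\<close> columns to the left
  contributes the polynomial once, and each of the \<open>q\<close> cells above contributes its
  negative. The total factor is the content \<open>l - q\<close>.\<close>

lemma specht_eigen:
  fixes x :: "nat \<times> nat \<Rightarrow> 'a::field"
  assumes D: "young_diagram D" and inj: "inj_on x D"
  shows "(\<Sum>d\<in>D. \<Sum>c\<in>{c \<in> D. cell_before c d}. specht D (x \<circ> transpose c d))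
    = (\<Sum>(i, j)\<in>D. of_nat j - of_nat i) * specht D x"
  unfolding sum_distrib_right
proof (rule sum.cong[OF refl], clarify)
  fix q l assume d: "(q, l) \<in> D"
  have fin: "finite D" using D by (simp add: young_diagram_def)
  let ?S = "\<lambda>c. specht D (x \<circ> transpose c (q, l))"
  let ?A = "\<Union>j<l. (\<lambda>i. (i, j)) ` column D j" and ?B = "(\<lambda>i. (i, l)) ` {..<q}"
  have "{c \<in> D. cell_before c (q, l)} = ?A \<union> ?B"
  proof -
    have "(i, l) \<in> D" if "i < q" for i
      using D d that unfolding young_diagram_def by (blast intro: less_imp_le)
    then show ?thesis
      by (auto simp: cell_before_def column_def)
  qed
  then have "(\<Sum>c\<in>{c \<in> D. cell_before c (q, l)}. ?S c) = (\<Sum>c\<in>?A. ?S c) + (\<Sum>c\<in>?B. ?S c)"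
    using finite_column[OF fin] by (simp only:) (rule sum.union_disjoint; auto)
  also have "(\<Sum>c\<in>?A. ?S c) = (\<Sum>j<l. \<Sum>p\<in>column D j. ?S (p, j))"
    using finite_column[OF fin]
    by (subst sum.UNION_disjoint) (auto simp: sum.reindex inj_on_def)
  also have "\<dots> = of_nat l * specht D x"
    using specht_other_column[OF D inj d] by simp
  also have "(\<Sum>c\<in>?B. ?S c) = (\<Sum>p<q. ?S (p, l))"
    by (simp add: sum.reindex inj_on_def)
  also have "\<dots> = (\<Sum>p<q. - specht D x)"
  proof (rule sum.cong[OF refl])
    fix p assume p: "p \<in> {..<q}"
    then have "(p, l) \<in> D"
      using D d unfolding young_diagram_def by (meson lessThan_iff less_imp_le order_refl)
    then show "?S (p, l) = - specht D x"
      using specht_same_column[OF fin _ d] p by auto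
  qed
  also have "\<dots> = - (of_nat q * specht D x)"
    by simp
  finally show "(\<Sum>c\<in>{c \<in> D. cell_before c (q, l)}. ?S c) = (of_nat l - of_nat q) * specht D x"
    by (simp only: left_diff_distrib add_uminus_conv_diff)
qed

section \<open>Diagrams from Frobenius coordinates\<close>

text \<open>The hook of the largest arm and the largest leg is wrapped around the diagram of the others,
  which is shifted along the diagonal, so that its contents do not change.\<close>

lemma diagram_from_frobenius:
  assumes "finite A" "finite B" "card A = card B" "A \<subseteq> {..<p}" "B \<subseteq> {..<q}"
  shows "\<exists>D. young_diagram D \<and> D \<subseteq> {..<q} \<times> {..<p} \<and> card D = \<Sum>A + \<Sum>B + card A \<and>
    2 * (\<Sum>(i, j)\<in>D. int j - int i)
      = (\<Sum>a\<in>A. int a * (int a + 1)) - (\<Sum>b\<in>B. int b * (int b + 1))"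
  using assms
proof (induction "card A" arbitrary: A B p q)
  case 0
  then show ?case
    by (intro exI[of _ "{}"]) (auto simp: young_diagram_def)
next
  case (Suc m)
  define a where "a = Max A"
  define b where "b = Max B"
  have ne: "A \<noteq> {}" "B \<noteq> {}" using Suc by auto
  have a: "a \<in> A" "A - {a} \<subseteq> {..<a}"
    using ne Suc.prems by (auto simp: a_def order.strict_iff_order)
  have b: "b \<in> B" "B - {b} \<subseteq> {..<b}"
    using ne Suc.prems by (auto simp: b_def order.strict_iff_order)
  have "m = card (A - {a})" "card (A - {a}) = card (B - {b})"
    using Suc a b by auto
  \<comment> \<open>Taking the bounds \<open>p\<close> and \<open>q\<close> to be \<open>a\<close>
    and \<open>b\<close> confines the inner diagram to \<open>b\<close> rows and \<open>a\<close>
    columns; shifted by one, it still fits inside the hook, which is what makes \<open>E\<close> a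
    diagram.\<close>
  then obtain D where D: "young_diagram D" "D \<subseteq> {..<b} \<times> {..<a}"
      "card D = \<Sum>(A - {a}) + \<Sum>(B - {b}) + card (A - {a})"
      "2 * (\<Sum>(i, j)\<in>D. int j - int i)
        = (\<Sum>a\<in>A - {a}. int a * (int a + 1)) - (\<Sum>b\<in>B - {b}. int b * (int b + 1))"
    using Suc.hyps(1)[of "A - {a}" "B - {b}" a b] a b Suc.prems by auto
  let ?sh = "\<lambda>(i, j). (Suc i, Suc j)"
  \<comment> \<open>The corner belongs to \<open>?row\<close>, so the arm part has
    \<open>a + 1\<close> cells and the leg part \<open>b\<close>.\<close>
  let ?row = "(\<lambda>j. (0::nat, j)) ` {..a}" and ?col = "(\<lambda>i. (Suc i, 0::nat)) ` {..<b}"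
  define E where "E = ?sh ` D \<union> (?row \<union> ?col)"
  have fin: "finite D" using D by (simp add: young_diagram_def)
  have inj: "inj_on ?sh D" by (auto simp: inj_on_def)
  have mem: "(i, j) \<in> E \<longleftrightarrow> i = 0 \<and> j \<le> a \<or> j = 0 \<and> i \<le> b \<or>
      (\<exists>i' j'. i = Suc i' \<and> j = Suc j' \<and> (i', j') \<in> D)" for i j
    unfolding E_def by (cases i; cases j) (auto simp: image_iff Bex_def)
  have sum_E: "(\<Sum>c\<in>E. f c)
      = (\<Sum>(i, j)\<in>D. f (Suc i, Suc j)) + ((\<Sum>j\<le>a. f (0, j)) + (\<Sum>i<b. f (Suc i, 0)))"
    for f :: "nat \<times> nat \<Rightarrow> int"
  proof -
    have "(\<Sum>c\<in>?row \<union> ?col. f c) = (\<Sum>j\<le>a. f (0, j)) + (\<Sum>i<b. f (Suc i, 0))"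
      by (subst sum.union_disjoint) (auto simp: sum.reindex inj_on_def)
    moreover have "(\<Sum>c\<in>?sh ` D. f c) = (\<Sum>(i, j)\<in>D. f (Suc i, Suc j))"
      by (subst sum.reindex[OF inj]) (auto intro: sum.cong)
    ultimately show ?thesis
      unfolding E_def using fin by (subst sum.union_disjoint) auto
  qed
  have "young_diagram E"
    unfolding young_diagram_def
  proof (intro conjI allI impI)
    show "finite E" using fin by (simp add: E_def)
    fix i j i' j' assume ij: "(i, j) \<in> E" "i' \<le> i" "j' \<le> j"
    show "(i', j') \<in> E"
    proof (cases "i' = 0 \<or> j' = 0")
      case True
      have "i \<le> b" "j \<le> a" using ij(1) D(2) unfolding mem by auto
      then show ?thesis using True ij unfolding mem by auto
    next
      case False
      then obtain s t where st: "i' = Suc s" "j' = Suc t" by (metis not0_implies_Suc)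
      then obtain u v where uv: "i = Suc u" "j = Suc v" "(u, v) \<in> D"
        using ij unfolding mem by auto
      have "(s, t) \<in> D"
        using D(1) uv st ij unfolding young_diagram_def by (metis Suc_le_mono)
      then show ?thesis using st unfolding mem by auto
    qed
  qed
  moreover have "E \<subseteq> {..<q} \<times> {..<p}"
  proof -
    have "a < p" "b < q" using a b Suc.prems by auto
    then show ?thesis using D(2) unfolding E_def by fastforce
  qed
  moreover have "card E = \<Sum>A + \<Sum>B + card A"
  proof -
    have "int (card E) = int (card D) + int a + 1 + int b"
      using sum_E[of "\<lambda>_. 1"] by (simp add: case_prod_beta)
    moreover have "\<Sum>A = a + \<Sum>(A - {a})" "\<Sum>B = b + \<Sum>(B - {b})"
      using a b Suc.prems by (auto simp: sum.remove)
    moreover have "card A = Suc (card (A - {a}))"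
      using \<open>m = card (A - {a})\<close> Suc.hyps(2) by simp
    ultimately show ?thesis using D(3) by linarith
  qed
  moreover have "2 * (\<Sum>(i, j)\<in>E. int j - int i)
      = (\<Sum>a\<in>A. int a * (int a + 1)) - (\<Sum>b\<in>B. int b * (int b + 1))"
  proof -
    have gauss: "2 * (\<Sum>j\<le>a. int j) = int a * (int a + 1)" for a
      by (induction a) (auto simp: algebra_simps)
    have gauss': "2 * (\<Sum>i<b. - int (Suc i)) = - (int b * (int b + 1))" for b
      by (induction b) (auto simp: algebra_simps)
    have "(\<Sum>(i, j)\<in>E. int j - int i)
        = (\<Sum>(i, j)\<in>D. int j - int i) + ((\<Sum>j\<le>a. int j) + (\<Sum>i<b. - int (Suc i)))"
      using sum_E[of "\<lambda>(i, j). int j - int i"] by simp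
    then have "2 * (\<Sum>(i, j)\<in>E. int j - int i) = 2 * (\<Sum>(i, j)\<in>D. int j - int i)
        + 2 * (\<Sum>j\<le>a. int j) + 2 * (\<Sum>i<b. - int (Suc i))"
      by (simp only: distrib_left add.assoc)
    moreover have "(\<Sum>a\<in>A. int a * (int a + 1)) = int a * (int a + 1)
        + (\<Sum>a\<in>A - {a}. int a * (int a + 1))"
      "(\<Sum>b\<in>B. int b * (int b + 1)) = int b * (int b + 1)
        + (\<Sum>b\<in>B - {b}. int b * (int b + 1))"
      using a b Suc.prems by (auto simp: sum.remove)
    ultimately show ?thesis
      unfolding gauss gauss' D(4) by linarith
  qed
  ultimately show ?case by blast
qed

section \<open>Eigenvectors of the transposition graph\<close>

lemma transpose_eq_transposeD:
  assumes "transpose i j = transpose k l" "i \<noteq> j"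
  shows "i = k \<and> j = l \<or> i = l \<and> j = k"
  using fun_cong[OF assms(1), of i] fun_cong[OF assms(1), of j] assms(2)
  by (auto simp: transpose_def split: if_splits)

text \<open>Adjacency is defined by multiplying with a transposition on the left. Conjugation by
  \<open>u\<close> moves it to the right, where it permutes the arguments of \<open>u\<close>, that
  is, the labels of the cells.\<close>

lemma parcs_transposition_graph:
  "(u, v) \<in> parcs (transposition_graph n) \<longleftrightarrow> u permutes {1..n} \<and>
    (\<exists>i\<in>{1..n}. \<exists>j\<in>{1..n}. i \<noteq> j \<and> v = u \<circ> transpose i j)"
  (is "?L \<longleftrightarrow> ?R")
proof
  assume ?L
  then have u: "u permutes {1..n}" and v: "v permutes {1..n}"
    and uv: "u \<circ> inv' v \<in> transpositions n"
    by (auto simp: transposition_graph_def cayley_graph_def sym_group_carrier sym_group_mult)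
  from uv obtain i j where ij: "i \<in> {1..n}" "j \<in> {1..n}" "i \<noteq> j" "u \<circ> inv' v = transpose i j"
    by (auto simp: transpositions_def)
  have "u = transpose i j \<circ> v"
    using ij(4) v by (metis comp_assoc comp_id permutes_inv_o(2))
  then have "v = transpose i j \<circ> u"
    by (metis comp_assoc comp_id id_comp transpose_comp_involutory)
  also have "\<dots> = u \<circ> transpose (inv' u i) (inv' u j)"
    using u by (auto simp: fun_eq_iff transpose_def permutes_inverses permutes_inv_eq)
  finally have "v = u \<circ> transpose (inv' u i) (inv' u j)" .
  moreover have "inv' u i \<in> {1..n}" "inv' u j \<in> {1..n}"
    using ij permutes_in_image[OF permutes_inv[OF u]] by auto
  moreover have "inv' u i \<noteq> inv' u j"
    using ij(3) permutes_inverses(1)[OF u] by metis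
  ultimately show ?R
    using u by blast
next
  assume R: ?R
  then obtain i j where u: "u permutes {1..n}" and ij: "i \<in> {1..n}" "j \<in> {1..n}" "i \<noteq> j"
    and v: "v = u \<circ> transpose i j" by blast
  have vp: "v permutes {1..n}"
    unfolding v using u ij by (intro permutes_compose permutes_swap_id)
  have "u = transpose (u i) (u j) \<circ> v"
    unfolding v using u by (auto simp: fun_eq_iff transpose_def permutes_inverses dest: permutes_inj injD)
  then have "u \<circ> inv' v = transpose (u i) (u j)"
    using vp by (metis comp_assoc comp_id permutes_inv_o(1))
  moreover have "u i \<in> {1..n}" "u j \<in> {1..n}" "u i \<noteq> u j"
    using u ij permutes_in_image[OF u] permutes_inj[OF u] by (auto dest: injD)
  ultimately show ?L
    using u vp by (auto simp: transposition_graph_def cayley_graph_def sym_group_carrier sym_group_mult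
        transpositions_def)
qed

lemma content_sum_eigenvalue:
  assumes D: "young_diagram D" and n: "card D = n"
  shows "graph_eigenvalue (transposition_graph n) (\<Sum>(i, j)\<in>D. real j - real i)"
proof -
  have fin: "finite D" using D by (simp add: young_diagram_def)
  define V where "V = {u. u permutes {1..n}}"
  have V: "pverts (transposition_graph n) = V" "finite V"
    by (auto simp: transposition_graph_def cayley_graph_def sym_group_def V_def finite_permutations)
  obtain vs where vs: "distinct vs" "set vs = V"
    using finite_distinct_list[OF V(2)] by blast
  obtain e where e: "bij_betw e D {1..n}"
    using finite_same_card_bij[OF fin, of "{1..n}"] n by auto
  have eD: "e c \<in> {1..n}" if "c \<in> D" for c
    using e that bij_betwE by blast
  have e_eq: "e c = e d \<longleftrightarrow> c = d" if "c \<in> D" "d \<in> D" for c d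
    using e that by (auto simp: bij_betw_def inj_on_eq_iff)
  define f where "f u = specht D (\<lambda>c. real (u (e c)))" for u
  have inj: "inj_on (\<lambda>c. real (u (e c))) D" if "u \<in> V" for u
    using that e_eq permutes_inj[of u "{1..n}"] by (simp add: V_def inj_on_def) blast
  have "\<exists>v\<in>V. f v \<noteq> 0"
    using specht_nonzero[OF fin inj[of id]]
    by (intro bexI[of _ id]) (auto simp: f_def V_def permutes_id)
  moreover have "(\<Sum>v\<in>V. if (u, v) \<in> parcs (transposition_graph n) then f v else 0)
      = (\<Sum>(i, j)\<in>D. real j - real i) * f u" if u: "u \<in> V" for u
  proof -
    \<comment> \<open>Each transposition, hence each neighbour of \<open>u\<close>, should come from
      exactly one pair in \<open>?P\<close>, so that the sum over neighbours becomes the double sum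
      of \<open>specht_eigen\<close>.\<close>
    let ?P = "SIGMA d:D. {c \<in> D. cell_before c d}"
    let ?h = "\<lambda>(d, c). u \<circ> transpose (e c) (e d)"
    have up: "u permutes {1..n}" using u by (simp add: V_def)
    have before: "cell_before c d \<or> cell_before d c" if "c \<noteq> d" for c d
      using that by (cases c; cases d) (auto simp: cell_before_def)
    have neq: "c \<noteq> d \<and> \<not> cell_before d c" if "cell_before c d" for c d
      using that by (auto simp: cell_before_def)
    have "inj_on ?h ?P"
    proof (rule inj_onI, clarify)
      fix d c d' c'
      assume m: "d \<in> D" "c \<in> D" "cell_before c d" "d' \<in> D" "c' \<in> D" "cell_before c' d'"
        and eq: "u \<circ> transpose (e c) (e d) = u \<circ> transpose (e c') (e d')"
      have "transpose (e c) (e d) = transpose (e c') (e d')"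
        using eq permutes_inj[OF up] by (metis fun.inj_map_strong injD)
      \<comment> \<open>A transposition determines its two points only up to order; the asymmetry of
        \<open>cell_before\<close> settles the order.\<close>
      then have "c = c' \<and> d = d' \<or> c = d' \<and> d = c'"
        using transpose_eq_transposeD m neq e_eq by metis
      then show "d = d' \<and> c = c'" using m neq by blast
    qed
    moreover have "?h ` ?P = {v \<in> V. (u, v) \<in> parcs (transposition_graph n)}" (is "_ = ?N")
    proof
      show "?h ` ?P \<subseteq> ?N"
      proof clarify
        fix d c assume m: "d \<in> D" "c \<in> D" "cell_before c d"
        have "u \<circ> transpose (e c) (e d) permutes {1..n}"
          using up eD m by (intro permutes_compose permutes_swap_id)
        then show "u \<circ> transpose (e c) (e d) \<in> V \<and>
            (u, u \<circ> transpose (e c) (e d)) \<in> parcs (transposition_graph n)"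
          unfolding parcs_transposition_graph V_def mem_Collect_eq
          using up eD[OF m(1)] eD[OF m(2)] neq[OF m(3)] e_eq[OF m(2,1)] by blast
      qed
      show "?N \<subseteq> ?h ` ?P"
      proof clarify
        fix v assume "v \<in> V" "(u, v) \<in> parcs (transposition_graph n)"
        then obtain i j where ij: "i \<in> {1..n}" "j \<in> {1..n}" "i \<noteq> j" "v = u \<circ> transpose i j"
          unfolding parcs_transposition_graph by blast
        then obtain c d where cd: "c \<in> D" "d \<in> D" "i = e c" "j = e d"
          using e unfolding bij_betw_def by blast
        then have "c \<noteq> d" using ij by auto
        then consider "cell_before c d" | "cell_before d c" using before by blast
        then show "v \<in> ?h ` ?P"
        proof cases
          case 1
          then show ?thesis using cd ij by (intro image_eqI[of _ _ "(d, c)"]) auto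
        next
          case 2
          then show ?thesis using cd ij
            by (intro image_eqI[of _ _ "(c, d)"]) (auto simp: transpose_commute)
        qed
      qed
    qed
    ultimately have bij: "bij_betw ?h ?P ?N" by (simp add: bij_betw_def)
    have "(\<Sum>v\<in>V. if (u, v) \<in> parcs (transposition_graph n) then f v else 0) = (\<Sum>v\<in>?N. f v)"
      using V(2) by (simp add: sum.inter_filter)
    also have "\<dots> = (\<Sum>(d, c)\<in>?P. f (u \<circ> transpose (e c) (e d)))"
      using sum.reindex_bij_betw[OF bij, of f] by (simp add: case_prod_beta)
    also have "\<dots> = (\<Sum>d\<in>D. \<Sum>c\<in>{c \<in> D. cell_before c d}. f (u \<circ> transpose (e c) (e d)))"
      using fin by (subst sum.Sigma) auto
    also have "\<dots> = (\<Sum>d\<in>D. \<Sum>c\<in>{c \<in> D. cell_before c d}.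
        specht D ((\<lambda>c. real (u (e c))) \<circ> transpose c d))"
    proof (intro sum.cong refl)
      fix d c assume m: "d \<in> D" "c \<in> {c \<in> D. cell_before c d}"
      \<comment> \<open>As \<open>e\<close> is injective on \<open>D\<close>, exchanging the labels
        \<open>e c\<close> and \<open>e d\<close> amounts to exchanging the cells.\<close>
      show "f (u \<circ> transpose (e c) (e d)) = specht D ((\<lambda>c. real (u (e c))) \<circ> transpose c d)"
        unfolding f_def using m e_eq by (intro specht_cong) (auto simp: transpose_def)
    qed
    also have "\<dots> = (\<Sum>(i, j)\<in>D. real j - real i) * f u"
      unfolding f_def by (rule specht_eigen[OF D inj[OF u]])
    finally show ?thesis .
  qed
  ultimately have "eigenvalue (adjacency_mat (transposition_graph n) vs) (\<Sum>(i, j)\<in>D. real j - real i)"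
    unfolding eigenvalue_adjacency_mat_iff[OF vs] by blast
  then show ?thesis
    unfolding graph_eigenvalue_def V(1) using vs by blast
qed

text \<open>This reduces the theorem to finding arms and legs with prescribed size and content sum.
  The doubled \<open>k\<close> avoids halving products of consecutive integers.\<close>

lemma frobenius_eigenvalue:
  assumes "finite A" "finite B" "card A = card B" "\<Sum>A + \<Sum>B + card A = n"
    and k: "2 * k = (\<Sum>a\<in>A. int a * (int a + 1)) - (\<Sum>b\<in>B. int b * (int b + 1))"
  shows "graph_eigenvalue (transposition_graph n) (real_of_int k)"
proof -
  have "A \<subseteq> {..<Suc (Max A)}" "B \<subseteq> {..<Suc (Max B)}"
    using assms(1,2) by (auto simp: less_Suc_eq_le)
  then obtain D where D: "young_diagram D" "card D = n" "2 * (\<Sum>(i, j)\<in>D. int j - int i) = 2 * k"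
    using diagram_from_frobenius[OF assms(1-3)] unfolding assms(4) k by blast
  have "real_of_int k = real_of_int (\<Sum>(i, j)\<in>D. int j - int i)"
    using D(3) by simp
  also have "\<dots> = (\<Sum>(i, j)\<in>D. real j - real i)"
    by (simp add: case_prod_beta)
  finally have "real_of_int k = (\<Sum>(i, j)\<in>D. real j - real i)" .
  then show ?thesis
    using content_sum_eigenvalue[OF D(1,2)] by simp
qed

section \<open>Arms and legs for every integer of the interval\<close>

theorem theorem3p1:
  fixes n a :: nat and k :: int
  assumes "n \<ge> 24"
    and "3 \<le> a"
    and "int a \<le> \<lfloor>(real n - 15) / 3\<rfloor>"
    and "[int n - int a = 1] (mod 2)"
    and "k \<in> {int ((a - 1) choose 2) + 1 .. int (a choose 2)}"
  shows "graph_eigenvalue (transposition_graph n) (real_of_int k)"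
proof -
  have "real a \<le> (real n - 15) / 3"
    using assms(3) by (simp add: le_floor_iff)
  then have an: "3 * a + 15 \<le> n" by simp
  define m where "m = (n - a) div 2"
  have "(int n - int a) mod 2 = 1"
    using assms(4) by (simp add: cong_def)
  then have "odd (n - a)"
    using an by presburger
  then have nm: "n = 2 * m + 1 + a"
    using an odd_two_times_div_two_succ[of "n - a"] unfolding m_def by linarith
  have ma: "a + 7 \<le> m" using nm an by linarith
  have choose: "2 * int (b choose 2) = int b * (int b - 1)" for b
    by (induction b) (auto simp: algebra_simps numeral_2_eq_2)
  \<comment> \<open>\<open>r\<close> measures the distance of \<open>k\<close> from the top of the
    interval. The interval has \<open>a - 1\<close> elements, whence \<open>r\<close> is at most
    \<open>a - 2\<close>.\<close>
  define r where "r = nat (int (a choose 2) - k)"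
  have k: "k = int (a choose 2) - int r" using assms(5) by (simp add: r_def)
  have "a choose 2 = (a - 1 choose 2) + (a - 1)"
    using assms(2) by (cases a) (auto simp: numeral_2_eq_2)
  then have r: "r + 2 \<le> a"
    using assms(2,5) k by auto
  have k2: "2 * k = int a * (int a - 1) - 2 * int r"
    unfolding k using choose[of a] by (simp add: right_diff_distrib)
  \<comment> \<open>The cases \<open>first\<close> and \<open>second\<close> are the possible
    coincidences among the arms \<open>m - r, a - 1, r - 1\<close> or among the legs
    \<open>m - r, r, 0\<close>; the other ones are excluded by \<open>0 < r\<close>,
    \<open>r + 2 \<le> a\<close> and \<open>a + 7 \<le> m\<close>.\<close>
  consider (zero) "r = 0" | (first) "r > 0" "m - r = a - 1"
    | (second) "r > 0" "m - r = r \<or> m - r = r - 1"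
    | (generic) "r > 0" "m - r \<noteq> a - 1" "m - r \<noteq> r" "m - r \<noteq> r - 1"
    by blast
  then show ?thesis
  proof cases
    case zero
    show ?thesis
      by (rule frobenius_eigenvalue[of "{m, a - 1}" "{m, 0}"])
        (use zero ma nm k2 assms(2) in \<open>auto simp: of_nat_diff algebra_simps\<close>)
  next
    case generic
    show ?thesis
      by (rule frobenius_eigenvalue[of "{m - r, a - 1, r - 1}" "{m - r, r, 0}"])
        (use generic ma nm k2 r in \<open>auto simp: of_nat_diff algebra_simps\<close>)
  next
    \<comment> \<open>The leg 0 is raised to 2, which lowers the content sum by 3; replacing the
      pair \<open>r - 1, r\<close> by \<open>r - 4, r - 3\<close> restores it. Four cells are then
      missing, and raising the common arm and leg \<open>m - r = b\<close> to \<open>b + 2\<close>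
      supplies them without changing the content sum.\<close>
    case first
    then have "r \<ge> 4" "a \<ge> 1" using ma r by auto
    then obtain s b where sb: "r = s + 4" "a = b + 1" by (metis le_add_diff_inverse2)
    have m: "m = b + s + 4" "s + 5 \<le> b" "4 \<le> s" using first sb ma r by auto
    show ?thesis
      by (rule frobenius_eigenvalue[of "{b + 2, b, s}" "{b + 2, s + 1, 2}"])
        (use m nm k2 sb in \<open>simp_all add: algebra_simps\<close>)
  next
    \<comment> \<open>An extra arm 1 and leg 2 change the content sum by -2 and add four cells,
      counting the new diagonal one. Lowering the pair \<open>r - 1, r\<close> by 2 compensates
      both, and \<open>t = m - r\<close> no longer meets it.\<close>
    case second
    then have "r \<ge> 3" "a \<ge> 1" "r \<le> m" using ma r by auto
    then obtain s b t where sb: "r = s + 3" "a = b + 1" "m = t + r"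
      by (metis le_add_diff_inverse2)
    have "s + 4 \<le> b" "6 \<le> s" "t = s + 2 \<or> t = s + 3" using second sb ma r by auto
    then show ?thesis
      by (intro frobenius_eigenvalue[of "{t, b, s, 1}" "{t, s + 1, 2, 0}"])
        (use nm k2 sb in \<open>auto simp: algebra_simps\<close>)
  qed
qed

end
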